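(* Let $T$ be a tree-like partial order of size $n$. The number of linear extensions of $T$ can be computed in $O(n)$ arithmetic operations.
   Context: A tree-like partial order (tree-poset) is a partial order on the node set of a rooted tree $T$ with $n$ nodes, generated by the relations $a\prec b$ whenever $a$ is the parent of $b$ in $T$ (so the root is the minimum). A linear extension is a total order on the nodes that respects this partial order. The input is the tree $T$, and complexity is measured by the number of arithmetic operations. *)

theory Defs
  imports Main "HOL-Library.Landau_Symbols"
begin

section \<open>Rooted trees, tree posets and linear extensions\<close>

text \<open>A pair \<open>(u, v) \<in> E\<close> means that \<open>u\<close> is the parent of \<open>v\<close>.\<close>

definition rooted_tree :: "'a set \<Rightarrow> 'a \<Rightarrow> ('a \<times> 'a) set \<Rightarrow> bool" where
  "rooted_tree V r E \<longleftrightarrow>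
     finite V \<and> r \<in> V \<and> E \<subseteq> V \<times> V \<and>
     (\<forall>u. (u, r) \<notin> E) \<and>
     (\<forall>v\<in>V - {r}. \<exists>!u. (u, v) \<in> E) \<and>
     (\<forall>v\<in>V. (r, v) \<in> E\<^sup>*)"

text \<open>The intersection restricts the reflexive pairs in \<open>E\<^sup>*\<close> to the node set.\<close>

definition tree_order :: "'a set \<Rightarrow> ('a \<times> 'a) set \<Rightarrow> ('a \<times> 'a) set" where
  "tree_order V E = E\<^sup>* \<inter> V \<times> V"

definition linear_extensions :: "'a set \<Rightarrow> ('a \<times> 'a) set \<Rightarrow> ('a \<times> 'a) set set" where
  "linear_extensions V R = {L. linear_order_on V L \<and> R \<subseteq> L}"

lemma partial_order_on_tree_order:
  assumes "rooted_tree V r E"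
  shows "partial_order_on V (tree_order V E)"
proof -
  have par: "\<And>u v w. (u, v) \<in> E \<Longrightarrow> (w, v) \<in> E \<Longrightarrow> u = w"
    using assms unfolding rooted_tree_def by blast
  have no_cycle: "(v, v) \<notin> E\<^sup>+" if "(r, v) \<in> E\<^sup>*" for v
    using that
  proof (induction rule: rtrancl_induct)
    case base
    then show ?case using assms by (auto simp: rooted_tree_def elim: tranclE)
  next
    case (step u v)
    show ?case
    proof
      assume "(v, v) \<in> E\<^sup>+"
      then obtain w where "(v, w) \<in> E\<^sup>*" "(w, v) \<in> E"
        by (auto dest: tranclD2)
      then have "(v, u) \<in> E\<^sup>*" using par step.hyps(2) by blast
      then show False using step by (meson rtrancl_into_trancl2)
    qed
  qed
  have "antisym (tree_order V E)"
  proof (rule antisymI)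
    fix x y assume "(x, y) \<in> tree_order V E" "(y, x) \<in> tree_order V E"
    then have "x \<in> V" "(x, y) \<in> E\<^sup>*" "(y, x) \<in> E\<^sup>*" by (auto simp: tree_order_def)
    moreover have "(x, x) \<notin> E\<^sup>+" using no_cycle assms \<open>x \<in> V\<close> by (auto simp: rooted_tree_def)
    ultimately show "x = y" by (metis rtranclD trancl_rtrancl_trancl)
  qed
  then show ?thesis
    unfolding partial_order_on_def preorder_on_def tree_order_def
    by (auto simp: refl_on_def intro!: transI)
qed


section \<open>A small imperative language with unit-cost arithmetic\<close>

text \<open>
  A state consists of integer variables and integer arrays.  Every arithmetic operation and every
  comparison costs one unit; constants, copying and array accesses are free.  The free commands
  cannot be exploited: each loop iteration pays for its comparison, so the total number of commands
  executed by a fixed program is bounded by a constant multiple of one plus its cost.  In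
  particular there is no free arithmetic on array indices.

  Division is defined only if it is exact, so that all four operations are those of the field of
  rational numbers and neither rounding nor bit manipulation comes for free.
\<close>

datatype arith_op = Add | Sub | Mul | Div

fun arith :: "arith_op \<Rightarrow> int \<Rightarrow> int \<Rightarrow> int option" where
  "arith Add a b = Some (a + b)"
| "arith Sub a b = Some (a - b)"
| "arith Mul a b = Some (a * b)"
| "arith Div a b = (if b \<noteq> 0 \<and> b dvd a then Some (a div b) else None)"

datatype cmp_op = Eq | Neq | Le | Less

fun compare :: "cmp_op \<Rightarrow> int \<Rightarrow> int \<Rightarrow> bool" where
  "compare Eq a b \<longleftrightarrow> a = b"
| "compare Neq a b \<longleftrightarrow> a \<noteq> b"
| "compare Le a b \<longleftrightarrow> a \<le> b"
| "compare Less a b \<longleftrightarrow> a < b"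

type_synonym name = string

record state =
  var :: "name \<Rightarrow> int"
  arr :: "name \<Rightarrow> int \<Rightarrow> int"

abbreviation set_var :: "name \<Rightarrow> int \<Rightarrow> state \<Rightarrow> state" where
  "set_var x a s \<equiv> s\<lparr>var := (var s)(x := a)\<rparr>"

abbreviation set_arr :: "name \<Rightarrow> int \<Rightarrow> int \<Rightarrow> state \<Rightarrow> state" where
  "set_arr A i a s \<equiv> s\<lparr>arr := (arr s)(A := (arr s A)(i := a))\<rparr>"

datatype com =
    Skip
  | Const name int                          \<comment> \<open>\<open>x := c\<close>\<close>
  | Copy name name                          \<comment> \<open>\<open>x := y\<close>\<close>
  | Load name name name                     \<comment> \<open>\<open>x := A[i]\<close>\<close>
  | Store name name name                    \<comment> \<open>\<open>A[i] := x\<close>\<close>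
  | Arith name arith_op name name           \<comment> \<open>\<open>x := y \<circ> z\<close>\<close>
  | Seq com com
  | Cond cmp_op name name com com
  | While cmp_op name name com

text \<open>\<open>exec c s k s'\<close>: started in \<open>s\<close>, the command \<open>c\<close> terminates in \<open>s'\<close> at cost \<open>k\<close>.\<close>

inductive exec :: "com \<Rightarrow> state \<Rightarrow> nat \<Rightarrow> state \<Rightarrow> bool" where
  Skip: "exec Skip s 0 s"
| Const: "exec (Const x a) s 0 (set_var x a s)"
| Copy: "exec (Copy x y) s 0 (set_var x (var s y) s)"
| Load: "exec (Load x A i) s 0 (set_var x (arr s A (var s i)) s)"
| Store: "exec (Store A i x) s 0 (set_arr A (var s i) (var s x) s)"
| Arith: "arith f (var s y) (var s z) = Some a \<Longrightarrow> exec (Arith x f y z) s 1 (set_var x a s)"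
| Seq: "exec c1 s k s' \<Longrightarrow> exec c2 s' l s'' \<Longrightarrow> exec (Seq c1 c2) s (k + l) s''"
| CondTrue: "compare p (var s x) (var s y) \<Longrightarrow> exec c1 s k s' \<Longrightarrow>
    exec (Cond p x y c1 c2) s (Suc k) s'"
| CondFalse: "\<not> compare p (var s x) (var s y) \<Longrightarrow> exec c2 s k s' \<Longrightarrow>
    exec (Cond p x y c1 c2) s (Suc k) s'"
| WhileFalse: "\<not> compare p (var s x) (var s y) \<Longrightarrow> exec (While p x y c) s 1 s"
| WhileTrue: "compare p (var s x) (var s y) \<Longrightarrow> exec c s k s' \<Longrightarrow>
    exec (While p x y c) s' l s'' \<Longrightarrow> exec (While p x y c) s (Suc (k + l)) s''"

inductive_cases SkipE [elim!]: "exec Skip s k t"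
inductive_cases ConstE [elim!]: "exec (Const x a) s k t"
inductive_cases CopyE [elim!]: "exec (Copy x y) s k t"
inductive_cases LoadE [elim!]: "exec (Load x A i) s k t"
inductive_cases StoreE [elim!]: "exec (Store A i x) s k t"
inductive_cases ArithE [elim!]: "exec (Arith x f y z) s k t"
inductive_cases SeqE [elim!]: "exec (Seq c1 c2) s k t"
inductive_cases CondE [elim!]: "exec (Cond p x y c1 c2) s k t"
inductive_cases WhileE: "exec (While p x y c) s k t"

lemma exec_deterministic:
  "exec c s k t \<Longrightarrow> exec c s k' t' \<Longrightarrow> k = k' \<and> t = t'"
proof (induction arbitrary: k' t' rule: exec.induct)
  case (Seq c1 s k s' c2 l s'')
  from Seq.prems show ?case using Seq.IH by (elim SeqE) blast
next
  case (CondTrue p s x y c1 k s' c2)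
  from CondTrue.prems show ?case using CondTrue.IH CondTrue.hyps by (elim CondE) blast+
next
  case (CondFalse p s x y c2 k s' c1)
  from CondFalse.prems show ?case using CondFalse.IH CondFalse.hyps by (elim CondE) blast+
next
  case (WhileFalse p s x y c)
  from WhileFalse.prems show ?case using WhileFalse.hyps by - (erule WhileE; simp)
next
  case (WhileTrue p s x y c k s' l s'')
  from WhileTrue.prems show ?case using WhileTrue.IH WhileTrue.hyps by - (erule WhileE; blast)
qed auto


section \<open>Input encoding\<close>

text \<open>
  A tree on the nodes \<open>0, \<dots>, n - 1\<close>, numbered arbitrarily, is given by \<open>n\<close> and its parent array, in
  which the root is marked by \<open>-1\<close>.  All other memory is zero.
\<close>

definition tree_input :: "nat \<Rightarrow> nat \<Rightarrow> (nat \<times> nat) set \<Rightarrow> state" where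
  "tree_input n r E =
     \<lparr>var = (\<lambda>_. 0)(''n'' := int n),
      arr = (\<lambda>_ _. 0)(''parent'' := (\<lambda>i.
        if i < 0 \<or> int n \<le> i then 0
        else if i = int r then - 1
        else int (THE u. (u, nat i) \<in> E)))\<rparr>"

end

theory Submission
  imports Defs
begin

text \<open>
  The program evaluates the hook length formula \<open>n! / (\<Prod>v. h v)\<close>, where \<open>h v\<close> is the size of the
  subtree at \<open>v\<close>.  The formula holds for every finite forest, by induction on its size: a linear
  extension starts with some root \<open>m\<close> and continues with a linear extension of the forest without
  \<open>m\<close>, in which all other hooks are unchanged.  Hence the number of linear extensions times the
  product of all hooks is the sum of \<open>h m * (n - 1)!\<close> over the roots \<open>m\<close>, and the hooks of the roots
  add up to \<open>n\<close>.

  The subtree sizes are computed by repeatedly removing a leaf.  A queue holds the nodes all of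
  whose children have been removed; each removal costs a constant number of operations.
\<close>

section \<open>The hook length formula\<close>

lemma linear_extensions_subset: "linear_extensions A R \<subseteq> Pow (A \<times> A)"
  unfolding linear_extensions_def order_on_defs by (auto simp: refl_on_def)

lemma finite_linear_extensions: "finite A \<Longrightarrow> finite (linear_extensions A R)"
  by (rule finite_subset[OF linear_extensions_subset]) simp

text \<open>Minimality of \<open>m\<close> means that a pair of \<open>R\<close> either starts at
  \<open>m\<close> or avoids \<open>m\<close> altogether, so the new row at \<open>m\<close> and the
  restricted relation together cover \<open>R\<close>.\<close>

lemma linear_extensions_insert_minimum:
  assumes R: "R \<subseteq> A \<times> A" and m: "m \<in> A" "\<And>x. (x, m) \<in> R \<Longrightarrow> x = m"
    and L: "L \<in> linear_extensions (A - {m}) (R \<inter> (A - {m}) \<times> (A - {m}))"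
  shows "L \<union> {m} \<times> A \<in> linear_extensions A R"
proof -
  have L': "L \<subseteq> (A - {m}) \<times> (A - {m})" using L linear_extensions_subset by blast
  have lin: "refl_on (A - {m}) L" "trans L" "antisym L" "total_on (A - {m}) L"
    using L by (simp_all add: linear_extensions_def order_on_defs)
  have "refl_on A (L \<union> {m} \<times> A)" using lin(1) m(1) by (auto simp: refl_on_def)
  moreover have "trans (L \<union> {m} \<times> A)"
    using L' m(1) transD[OF lin(2)] by (intro transI) blast
  moreover have "antisym (L \<union> {m} \<times> A)"
    using L' antisymD[OF lin(3)] by (intro antisymI) blast
  moreover have "total_on A (L \<union> {m} \<times> A)" using lin(4) by (auto simp: total_on_def)
  ultimately have "linear_order_on A (L \<union> {m} \<times> A)"
    using L' m(1) by (auto simp: order_on_defs)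
  moreover have "R \<subseteq> L \<union> {m} \<times> A"
    using L m(2) R unfolding linear_extensions_def by blast
  ultimately show ?thesis by (simp add: linear_extensions_def)
qed

lemma linear_order_on_minimum:
  assumes "linear_order_on A L" "finite A" "A \<noteq> {}"
  obtains m where "m \<in> A" "\<And>x. x \<in> A \<Longrightarrow> (m, x) \<in> L"
proof -
  \<comment> \<open>The induction runs over subsets \<open>B\<close> with \<open>L\<close> fixed, so
    that linearity of \<open>L\<close> on all of \<open>A\<close> stays available.\<close>
  have "\<exists>m\<in>B. \<forall>x\<in>B. (m, x) \<in> L" if "finite B" "B \<noteq> {}" "B \<subseteq> A" for B
    using that
  proof (induction B rule: finite_ne_induct)
    case (singleton x)
    then show ?case using assms(1) by (auto simp: order_on_defs refl_on_def)
  next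
    case (insert x B)
    then obtain m where m: "m \<in> B" "\<forall>y\<in>B. (m, y) \<in> L" by auto
    have mem: "x \<in> A" "m \<in> A" "x \<noteq> m" using insert m by auto
    have "trans L" "(x, x) \<in> L" and "(m, x) \<in> L \<or> (x, m) \<in> L"
      using assms(1) mem by (auto simp: order_on_defs refl_on_def total_on_def)
    then show ?case
    proof (elim disjE)
      assume "(m, x) \<in> L"
      then show ?thesis using m by auto
    next
      assume xm: "(x, m) \<in> L"
      then have "(x, y) \<in> L" if "y \<in> B" for y using m(2) that \<open>trans L\<close> by (meson transD)
      then show ?thesis using \<open>(x, x) \<in> L\<close> by auto
    qed
  qed
  from this[of A] show ?thesis using assms(2,3) that by auto
qed

text \<open>Inverse of the insertion of a minimum. By antisymmetry nothing but \<open>m\<close> lies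
  below \<open>m\<close>, so \<open>L\<close> consists of the row of \<open>m\<close> and its
  restriction to the other elements.\<close>

lemma linear_extensions_remove_minimum:
  assumes L: "L \<in> linear_extensions A R" and R: "R \<subseteq> A \<times> A"
    and m: "m \<in> A" "\<And>x. x \<in> A \<Longrightarrow> (m, x) \<in> L"
  shows "L \<inter> (A - {m}) \<times> (A - {m}) \<in> linear_extensions (A - {m}) (R \<inter> (A - {m}) \<times> (A - {m}))"
    and "L = L \<inter> (A - {m}) \<times> (A - {m}) \<union> {m} \<times> A"
    and "(x, m) \<in> R \<Longrightarrow> x = m"
proof -
  have LA: "L \<subseteq> A \<times> A" using L linear_extensions_subset by blast
  have anti: "antisym L" and RL: "R \<subseteq> L" using L by (auto simp: linear_extensions_def order_on_defs)
  then have least: "x = m" if "(x, m) \<in> L" for x using that m LA by (auto dest: antisymD)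
  show "(x, m) \<in> R \<Longrightarrow> x = m" using least RL by blast
  show "L = L \<inter> (A - {m}) \<times> (A - {m}) \<union> {m} \<times> A" using LA m least by blast
  show "L \<inter> (A - {m}) \<times> (A - {m}) \<in> linear_extensions (A - {m}) (R \<inter> (A - {m}) \<times> (A - {m}))"
    using L unfolding linear_extensions_def order_on_defs
    by (auto simp: refl_on_def total_on_def intro!: transI antisymI dest: transD antisymD)
qed

text \<open>Linear extensions are classified by their minimum, which must be minimal in
  \<open>R\<close>; within one class, deleting the minimum and putting it back are mutually
  inverse.\<close>

lemma card_linear_extensions_remove_minimal:
  assumes "finite A" "A \<noteq> {}" "R \<subseteq> A \<times> A"
  shows "card (linear_extensions A R) =
    (\<Sum>m\<in>{m\<in>A. \<forall>x. (x, m) \<in> R \<longrightarrow> x = m}.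
      card (linear_extensions (A - {m}) (R \<inter> (A - {m}) \<times> (A - {m}))))"
proof -
  define M where "M = {m\<in>A. \<forall>x. (x, m) \<in> R \<longrightarrow> x = m}"
  define F where "F m = linear_extensions (A - {m}) (R \<inter> (A - {m}) \<times> (A - {m}))" for m
  define G where "G m = (\<lambda>L. L \<union> {m} \<times> A) ` F m" for m
  have F: "L \<subseteq> (A - {m}) \<times> (A - {m})" if "L \<in> F m" for L m
    using that linear_extensions_subset unfolding F_def by blast
  have "linear_extensions A R \<subseteq> (\<Union>m\<in>M. G m)"
  proof
    fix L assume L: "L \<in> linear_extensions A R"
    then have "linear_order_on A L" by (simp add: linear_extensions_def)
    then obtain m where m: "m \<in> A" "\<And>x. x \<in> A \<Longrightarrow> (m, x) \<in> L"
      using assms linear_order_on_minimum by metis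
    note * = linear_extensions_remove_minimum[OF L assms(3) m]
    have "m \<in> M" using m(1) *(3) by (auto simp: M_def)
    moreover have "L \<in> G m" using *(1,2) unfolding G_def F_def by blast
    ultimately show "L \<in> (\<Union>m\<in>M. G m)" by blast
  qed
  moreover have "(\<Union>m\<in>M. G m) \<subseteq> linear_extensions A R"
    using linear_extensions_insert_minimum[OF assms(3)] unfolding M_def G_def F_def by blast
  ultimately have eq: "linear_extensions A R = (\<Union>m\<in>M. G m)" by blast
  have inj: "inj_on (\<lambda>L. L \<union> {m} \<times> A) (F m)" for m
    using F by (intro inj_onI) blast
  \<comment> \<open>The pair \<open>(m, m')\<close> separates the two classes: it belongs to every
    order with minimum \<open>m\<close> and to none with minimum \<open>m'\<close>.\<close>
  have disj: "G m \<inter> G m' = {}" if "m \<in> M" "m' \<in> M" "m \<noteq> m'" for m m'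
  proof -
    have "(m, m') \<in> L" if "L \<in> G m" for L using that \<open>m' \<in> M\<close> by (auto simp: G_def M_def)
    moreover have "(m, m') \<notin> L" if "L \<in> G m'" for L
      using that F \<open>m \<noteq> m'\<close> by (fastforce simp: G_def)
    ultimately show ?thesis by blast
  qed
  have "finite M" "\<And>m. finite (G m)"
    using assms(1) by (auto simp: M_def G_def F_def finite_linear_extensions)
  then have "card (linear_extensions A R) = (\<Sum>m\<in>M. card (G m))"
    unfolding eq using disj by (intro card_UN_disjoint) auto
  also have "\<dots> = (\<Sum>m\<in>M. card (F m))"
    using inj by (simp add: G_def card_image)
  finally show ?thesis unfolding M_def F_def .
qed

text \<open>Among the elements below \<open>v\<close>, one with the fewest predecessors is minimal:
  anything strictly below it would have a strictly smaller set of predecessors.\<close>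

lemma exists_minimal_below:
  assumes "finite A" "partial_order_on A R" "v \<in> A"
  obtains m where "(m, v) \<in> R" "m \<in> A" "\<And>x. (x, m) \<in> R \<Longrightarrow> x = m"
proof -
  have R: "R \<subseteq> A \<times> A" "trans R" "antisym R" "(v, v) \<in> R"
    using assms by (auto simp: order_on_defs refl_on_def)
  have fin: "finite (R\<inverse> `` {x})" for x
    using R(1) assms(1) by (auto intro: finite_subset)
  obtain m where m: "(m, v) \<in> R" "\<And>y. (y, v) \<in> R \<Longrightarrow> card (R\<inverse> `` {m}) \<le> card (R\<inverse> `` {y})"
    using ex_has_least_nat[of "\<lambda>m. (m, v) \<in> R" v "\<lambda>m. card (R\<inverse> `` {m})"] R(4) by blast
  have "x = m" if x: "(x, m) \<in> R" for x
  proof (rule ccontr)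
    assume "x \<noteq> m"
    then have "(m, x) \<notin> R" using x R(3) by (auto dest: antisymD)
    moreover have "(m, m) \<in> R" using m(1) R(1) assms by (auto simp: order_on_defs refl_on_def)
    moreover have "R\<inverse> `` {x} \<subseteq> R\<inverse> `` {m}" using x R(2) by (auto dest: transD)
    ultimately have "R\<inverse> `` {x} \<subset> R\<inverse> `` {m}" by blast
    then have "card (R\<inverse> `` {x}) < card (R\<inverse> `` {m})" using fin by (simp add: psubset_card_mono)
    moreover have "(x, v) \<in> R" using x m(1) R(2) by (auto dest: transD)
    ultimately show False using m(2) by fastforce
  qed
  then show ?thesis using that m(1) R(1) by blast
qed

lemma forest_hook_length_formula:
  assumes "finite A" "partial_order_on A R"
    and "\<And>x y z. (x, z) \<in> R \<Longrightarrow> (y, z) \<in> R \<Longrightarrow> (x, y) \<in> R \<or> (y, x) \<in> R"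
  shows "card (linear_extensions A R) * (\<Prod>v\<in>A. card (R `` {v})) = fact (card A)"
  using assms
proof (induction "card A" arbitrary: A R)
  case 0
  then have "A = {}" "R = {}" by (auto simp: order_on_defs)
  then have "linear_extensions A R = {{}}"
    by (auto simp: linear_extensions_def order_on_defs refl_on_def)
  then show ?case using \<open>A = {}\<close> by simp
next
  case (Suc n)
  have ne: "A \<noteq> {}" using Suc.hyps(2) by auto
  have R: "R \<subseteq> A \<times> A" "trans R" "antisym R" and refl: "\<And>x. x \<in> A \<Longrightarrow> (x, x) \<in> R"
    using Suc.prems(2) by (auto simp: order_on_defs refl_on_def)
  define M where "M = {m\<in>A. \<forall>x. (x, m) \<in> R \<longrightarrow> x = m}"
  define e where "e m = card (linear_extensions (A - {m}) (R \<inter> (A - {m}) \<times> (A - {m})))" for m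
  have finM: "finite M" "M \<subseteq> A" using Suc.prems(1) by (auto simp: M_def)
  have e: "e m * (\<Prod>v\<in>A. card (R `` {v})) = card (R `` {m}) * fact n" if m: "m \<in> M" for m
  proof -
    let ?A = "A - {m}" and ?R = "R \<inter> (A - {m}) \<times> (A - {m})"
    have po: "partial_order_on ?A ?R"
      using Suc.prems(2) unfolding order_on_defs refl_on_def trans_def antisym_def by blast
    have "card ?A = n" using m finM Suc.hyps(2) by auto
    then have "e m * (\<Prod>v\<in>?A. card (?R `` {v})) = fact n"
      unfolding e_def using Suc.hyps(1)[of ?A ?R] po Suc.prems(1,3) by blast
    \<comment> \<open>No other up-set contains the minimal element \<open>m\<close>, so deleting
      \<open>m\<close> changes no other hook.\<close>
    moreover have "?R `` {v} = R `` {v}" if "v \<in> ?A" for v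
      using m that R(1) by (auto simp: M_def)
    ultimately have "e m * (\<Prod>v\<in>?A. card (R `` {v})) = fact n" by simp
    then show ?thesis using m finM Suc.prems(1)
      by (subst prod.remove[of A m]) (auto simp: algebra_simps)
  qed
  \<comment> \<open>The up-sets of the minimal elements partition \<open>A\<close>. They cover it
    since every element has a minimal one below it; they are disjoint since two minimal elements
    below a common \<open>z\<close> are comparable, hence equal.\<close>
  have "(\<Union>m\<in>M. R `` {m}) = A"
  proof
    show "A \<subseteq> (\<Union>m\<in>M. R `` {m})"
      using exists_minimal_below[OF Suc.prems(1,2)] unfolding M_def by blast
  qed (use R(1) in auto)
  moreover have "card (\<Union>m\<in>M. R `` {m}) = (\<Sum>m\<in>M. card (R `` {m}))"
  proof (intro card_UN_disjoint ballI impI)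
    show "R `` {m} \<inter> R `` {m'} = {}" if "m \<in> M" "m' \<in> M" "m \<noteq> m'" for m m'
      using Suc.prems(3) that unfolding M_def by blast
  qed (use finM R(1) Suc.prems(1) in \<open>auto intro: finite_subset\<close>)
  ultimately have sum: "(\<Sum>m\<in>M. card (R `` {m})) = Suc n" using Suc.hyps(2) by simp
  have "card (linear_extensions A R) * (\<Prod>v\<in>A. card (R `` {v})) =
      (\<Sum>m\<in>M. e m * (\<Prod>v\<in>A. card (R `` {v})))"
    using card_linear_extensions_remove_minimal[OF Suc.prems(1) ne R(1)]
    by (simp add: M_def e_def sum_distrib_right)
  also have "\<dots> = (\<Sum>m\<in>M. card (R `` {m}) * fact n)" using e by simp
  also have "\<dots> = fact (card A)" using sum by (simp flip: sum_distrib_right Suc.hyps(2))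
  finally show ?case .
qed

section \<open>Rooted trees: their order is a forest order, and subtree sizes satisfy a
  recursion\<close>

lemma rooted_tree_parent_unique:
  "rooted_tree V r E \<Longrightarrow> (u, v) \<in> E \<Longrightarrow> (w, v) \<in> E \<Longrightarrow> u = w"
  unfolding rooted_tree_def by blast

lemma rooted_tree_parent_exists:
  "rooted_tree V r E \<Longrightarrow> v \<in> V \<Longrightarrow> v \<noteq> r \<Longrightarrow> \<exists>u. (u, v) \<in> E"
  unfolding rooted_tree_def by blast

text \<open>Induction along the path from \<open>x\<close>: a nontrivial path from \<open>y\<close>
  to the same end has the same last edge, because parents are unique.\<close>

lemma rooted_tree_ancestors_comparable:
  assumes "rooted_tree V r E" "(x, z) \<in> E\<^sup>*" "(y, z) \<in> E\<^sup>*"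
  shows "(x, y) \<in> E\<^sup>* \<or> (y, x) \<in> E\<^sup>*"
  using assms(2,3)
proof (induction rule: rtrancl_induct)
  case (step u v)
  then show ?case
    by (metis rooted_tree_parent_unique[OF assms(1)] rtranclE rtrancl.rtrancl_into_rtrancl)
qed auto

theorem tree_hook_length_formula:
  assumes "rooted_tree V r E"
  shows "card (linear_extensions V (tree_order V E)) * (\<Prod>v\<in>V. card (tree_order V E `` {v}))
    = fact (card V)"
proof (rule forest_hook_length_formula)
  show "finite V" using assms by (simp add: rooted_tree_def)
  show "partial_order_on V (tree_order V E)" using assms by (rule partial_order_on_tree_order)
qed (use rooted_tree_ancestors_comparable[OF assms] in \<open>auto simp: tree_order_def\<close>)

text \<open>Induction along the path from the root: a cycle through \<open>y\<close> enters
  \<open>y\<close> from its only parent \<open>x\<close> and is thus a cycle through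
  \<open>x\<close>, while no edge enters the root.\<close>

lemma rooted_tree_acyclic:
  assumes "rooted_tree V r E" "(u, v) \<in> E"
  shows "(v, u) \<notin> E\<^sup>*"
proof -
  have "(w, w) \<notin> E\<^sup>+" if "(r, w) \<in> E\<^sup>*" for w
    using that
  proof (induction rule: rtrancl_induct)
    case base
    then show ?case using assms(1) by (auto simp: rooted_tree_def elim: tranclE)
  next
    case (step x y)
    then show ?case
      by (metis rooted_tree_parent_unique[OF assms(1)] rtrancl_into_trancl2 tranclD2)
  qed
  moreover have "(r, v) \<in> E\<^sup>*" using assms by (auto simp: rooted_tree_def)
  ultimately show ?thesis using assms(2) by (meson rtrancl_into_trancl1)
qed

text \<open>The subtree at \<open>v\<close> consists of \<open>v\<close> and the pairwise disjoint
  subtrees at its children.\<close>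

lemma card_tree_order_Image:
  assumes "rooted_tree V r E" "v \<in> V"
  shows "card (tree_order V E `` {v}) = Suc (\<Sum>c | (v, c) \<in> E. card (tree_order V E `` {c}))"
proof -
  let ?T = "tree_order V E"
  have E: "E \<subseteq> V \<times> V" and finV: "finite V" using assms by (auto simp: rooted_tree_def)
  have fin: "finite {c. (v, c) \<in> E}" using E finV by (auto intro: finite_subset)
  have finT: "finite (?T `` S)" for S using finV by (auto simp: tree_order_def intro: finite_subset)
  have "?T `` {v} = insert v (\<Union>c\<in>{c. (v, c) \<in> E}. ?T `` {c})"
    using E assms(2) unfolding tree_order_def
    by (auto intro: converse_rtrancl_into_rtrancl) (metis SigmaD2 converse_rtranclE subsetD)
  moreover have "v \<notin> (\<Union>c\<in>{c. (v, c) \<in> E}. ?T `` {c})"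
    using rooted_tree_acyclic[OF assms(1)] by (auto simp: tree_order_def)
  moreover have "card (\<Union>c\<in>{c. (v, c) \<in> E}. ?T `` {c}) = (\<Sum>c | (v, c) \<in> E. card (?T `` {c}))"
  proof (intro card_UN_disjoint ballI impI)
    \<comment> \<open>A path between siblings would have to enter \<open>c'\<close> through
      \<open>v\<close>, and so would lead from the child \<open>c\<close> back to its
      parent.\<close>
    have aux: "(c, c') \<notin> E\<^sup>*" if "(v, c) \<in> E" "(v, c') \<in> E" "c \<noteq> c'" for c c'
      using that rooted_tree_acyclic[OF assms(1)] rooted_tree_parent_unique[OF assms(1)]
      by (metis rtranclE)
    show "?T `` {c} \<inter> ?T `` {c'} = {}"
      if "c \<in> {c. (v, c) \<in> E}" "c' \<in> {c. (v, c) \<in> E}" "c \<noteq> c'" for c c'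
      using that aux rooted_tree_ancestors_comparable[OF assms(1)] unfolding tree_order_def by blast
  qed (use fin finT in auto)
  ultimately show ?thesis using fin finT by simp
qed

section \<open>Weakest preconditions with cost\<close>

text \<open>This is total correctness: a run must exist, so termination and exactness of every
  division are included. The postcondition also receives the cost.\<close>

definition wp :: "com \<Rightarrow> (nat \<Rightarrow> state \<Rightarrow> bool) \<Rightarrow> state \<Rightarrow> bool" where
  "wp c Q s \<longleftrightarrow> (\<exists>k s'. exec c s k s' \<and> Q k s')"

lemma wp_Arith:
  "wp (Arith x f y z) Q s \<longleftrightarrow> (\<exists>a. arith f (var s y) (var s z) = Some a \<and> Q 1 (set_var x a s))"
  unfolding wp_def by (auto intro: exec.Arith[unfolded One_nat_def])

lemma wp_simps [simp]:
  "wp Skip Q s \<longleftrightarrow> Q 0 s"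
  "wp (Const x a) Q s \<longleftrightarrow> Q 0 (set_var x a s)"
  "wp (Copy x y) Q s \<longleftrightarrow> Q 0 (set_var x (var s y) s)"
  "wp (Load x A i) Q s \<longleftrightarrow> Q 0 (set_var x (arr s A (var s i)) s)"
  "wp (Store A i x) Q s \<longleftrightarrow> Q 0 (set_arr A (var s i) (var s x) s)"
  "wp (Cond p x y c1 c2) Q s \<longleftrightarrow>
    wp (if compare p (var s x) (var s y) then c1 else c2) (\<lambda>k. Q (Suc k)) s"
  unfolding wp_def by (auto intro: exec.intros)

lemma wp_Arith_simps [simp]:
  "wp (Arith x Add y z) Q s \<longleftrightarrow> Q 1 (set_var x (var s y + var s z) s)"
  "wp (Arith x Sub y z) Q s \<longleftrightarrow> Q 1 (set_var x (var s y - var s z) s)"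
  "wp (Arith x Mul y z) Q s \<longleftrightarrow> Q 1 (set_var x (var s y * var s z) s)"
  "wp (Arith x Div y z) Q s \<longleftrightarrow> var s z \<noteq> 0 \<and> var s z dvd var s y \<and>
    Q 1 (set_var x (var s y div var s z) s)"
  by (auto simp: wp_Arith)

lemma wp_Seq [simp]: "wp (Seq c1 c2) Q s \<longleftrightarrow> wp c1 (\<lambda>k. wp c2 (\<lambda>l. Q (k + l))) s"
  unfolding wp_def by (blast intro: exec.Seq)

lemma wp_mono: "wp c Q s \<Longrightarrow> (\<And>k s'. Q k s' \<Longrightarrow> Q' k s') \<Longrightarrow> wp c Q' s"
  unfolding wp_def by blast

text \<open>For loops with exactly \<open>N\<close> iterations; the invariant is indexed by the
  number of completed ones. Each iteration pays \<open>b\<close> for the body and one for its test,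
  and the last, failing test pays one more.\<close>

lemma wp_While_count:
  assumes step: "\<And>i s. i < N \<Longrightarrow> I i s \<Longrightarrow>
      compare p (var s x) (var s y) \<and> wp c (\<lambda>k s'. k \<le> b \<and> I (Suc i) s') s"
    and exit: "\<And>s. I N s \<Longrightarrow> \<not> compare p (var s x) (var s y)"
    and init: "I 0 s"
  shows "wp (While p x y c) (\<lambda>k s'. k \<le> N * Suc b + 1 \<and> I N s') s"
proof -
  \<comment> \<open>Here \<open>m\<close> is the number of iterations still to come.\<close>
  have "wp (While p x y c) (\<lambda>k s'. k \<le> m * Suc b + 1 \<and> I N s') s"
    if "m \<le> N" "I (N - m) s" for m s
    using that
  proof (induction m arbitrary: s)
    case 0
    then show ?case using exit[of s] unfolding wp_def
      by (intro exI[of _ 1] exI[of _ s]) (auto intro: exec.WhileFalse simp del: One_nat_def)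
  next
    case (Suc m)
    have "Suc (N - Suc m) = N - m" using Suc.prems(1) by simp
    then obtain k s' where 1: "compare p (var s x) (var s y)" "exec c s k s'" "k \<le> b" "I (N - m) s'"
      using step[OF _ Suc.prems(2)] Suc.prems(1) unfolding wp_def by auto
    then obtain l s'' where "exec (While p x y c) s' l s''" "l \<le> m * Suc b + 1" "I N s''"
      using Suc.IH[of s'] Suc.prems(1) unfolding wp_def by auto
    then show ?case using 1 unfolding wp_def
      by (intro exI[of _ "Suc (k + l)"] exI[of _ s'']) (auto intro: exec.WhileTrue)
  qed
  from this[of N s] show ?thesis using init by simp
qed

definition block :: "com list \<Rightarrow> com" where
  "block cs = foldr Seq cs Skip"

lemma wp_block [simp]:
  "wp (block []) Q s \<longleftrightarrow> Q 0 s"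
  "wp (block (c # cs)) Q s \<longleftrightarrow> wp c (\<lambda>k. wp (block cs) (\<lambda>l. Q (k + l))) s"
  by (simp_all add: block_def)

text \<open>Lets consecutive phases be bounded separately and their bounds added.\<close>

lemma wp_block_bound:
  assumes "wp c (\<lambda>k s'. k \<le> a \<and> P s') s"
    and "\<And>s'. P s' \<Longrightarrow> wp (block cs) (\<lambda>k s''. k \<le> b \<and> R s'') s'"
  shows "wp (block (c # cs)) (\<lambda>k s''. k \<le> a + b \<and> R s'') s"
  unfolding wp_block by (intro wp_mono[OF assms(1)] wp_mono[OF assms(2)]) auto

section \<open>Removing leaves\<close>

definition push :: "name \<Rightarrow> com" where
  "push x = block [Store ''queue'' ''t'' x, Arith ''t'' Add ''t'' ''one'']"

definition count_children :: com where
  "count_children = While Less ''i'' ''n'' (block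
    [Load ''p'' ''parent'' ''i'',
     Load ''d'' ''deg'' ''p'',
     Arith ''d'' Add ''d'' ''one'',
     Store ''deg'' ''p'' ''d'',
     Arith ''i'' Add ''i'' ''one''])"

definition push_leaves :: com where
  "push_leaves = While Less ''j'' ''n'' (block
    [Load ''d'' ''deg'' ''j'',
     Cond Eq ''d'' ''zero'' (push ''j'') Skip,
     Arith ''j'' Add ''j'' ''one''])"

text \<open>At each node \<open>size\<close> sums the hooks of the children removed so far, so
  adding one at removal gives the hook. The factorial is built in the same loop: \<open>h\<close> is
  incremented before it serves as a factor, which gives the factors
  \<open>1, ..., n\<close>.\<close>

definition peel_leaves :: com where
  "peel_leaves = While Less ''h'' ''n'' (block
    [Load ''v'' ''queue'' ''h'',
     Arith ''h'' Add ''h'' ''one'',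
     Load ''w'' ''size'' ''v'',
     Arith ''w'' Add ''w'' ''one'',
     Arith ''prod'' Mul ''prod'' ''w'',
     Arith ''fact'' Mul ''fact'' ''h'',
     Load ''p'' ''parent'' ''v'',
     Load ''d'' ''size'' ''p'',
     Arith ''d'' Add ''d'' ''w'',
     Store ''size'' ''p'' ''d'',
     Load ''d'' ''deg'' ''p'',
     Arith ''d'' Sub ''d'' ''one'',
     Store ''deg'' ''p'' ''d'',
     Cond Eq ''d'' ''zero'' (push ''p'') Skip])"

text \<open>
  The dummy node \<open>-1\<close>, the parent of the root, gets one child too many, so that it never enters the
  queue and needs no special treatment.
\<close>

definition count_linear_extensions :: com where
  "count_linear_extensions = block
    [Const ''one'' 1, Const ''prod'' 1, Const ''fact'' 1,
     Const ''p'' (- 1), Store ''deg'' ''p'' ''one'',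
     count_children, push_leaves, peel_leaves,
     Arith ''result'' Div ''fact'' ''prod'']"

section \<open>Removal of leaves, on an abstract parent function\<close>

text \<open>The tree enters only through the recursion for its hooks. Together with positivity this
  rules out cycles, since hooks strictly increase from a child to its parent.\<close>

locale parent_array =
  fixes n :: nat and par hook :: "int \<Rightarrow> int"
  assumes par: "v \<in> {0..<int n} \<Longrightarrow> par v \<in> insert (- 1) {0..<int n}"
    and hook_pos: "v \<in> {0..<int n} \<Longrightarrow> 0 < hook v"
    and hook_rec: "v \<in> {0..<int n} \<Longrightarrow> hook v = 1 + (\<Sum>u | u \<in> {0..<int n} \<and> par u = v. hook u)"
begin

abbreviation nodes :: "int set" where
  "nodes \<equiv> {0..<int n}"

definition children :: "int set \<Rightarrow> int \<Rightarrow> int set" where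
  "children S v = {u \<in> S. par u = v}"

lemma finite_children [simp]: "finite S \<Longrightarrow> finite (children S v)"
  by (simp add: children_def)

text \<open>A node of \<open>S\<close> with least hook is a leaf in \<open>S\<close>, as a child has
  a smaller hook than its parent.\<close>

lemma exists_leaf:
  assumes "S \<subseteq> nodes" "S \<noteq> {}"
  obtains v where "v \<in> S" "children S v = {}"
proof -
  have "finite S" using assms(1) by (rule finite_subset) simp
  then obtain v where v: "v \<in> S" "\<And>u. u \<in> S \<Longrightarrow> hook v \<le> hook u"
    using assms(2) arg_min_if_finite[of S hook] by (metis linorder_not_le)
  have "par u \<noteq> v" if "u \<in> S" for u
  proof
    assume "par u = v"
    then have "hook u \<le> (\<Sum>u | u \<in> nodes \<and> par u = v. hook u)"
      using that assms(1) hook_pos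
      by (intro member_le_sum) (auto simp: less_imp_le intro: finite_subset[of _ nodes])
    also have "\<dots> < hook v" using hook_rec[of v] v(1) assms(1) by auto
    finally show False using v(2)[OF that] by simp
  qed
  then show ?thesis using v(1) that by (auto simp: children_def)
qed

text \<open>The first \<open>i\<close> queue entries are the removed nodes; those from
  \<open>i\<close> to \<open>t\<close> are the leaves waiting for removal. Neither kind has a
  remaining child, so one condition describes the whole queue. The summand \<open>of_bool\<close> is
  the surplus child of the dummy node.\<close>

definition peeled :: "nat \<Rightarrow> (int \<Rightarrow> int) \<Rightarrow> int \<Rightarrow> (int \<Rightarrow> int) \<Rightarrow> (int \<Rightarrow> int) \<Rightarrow> bool" where
  "peeled i q t deg sz \<longleftrightarrow>
    inj_on q {0..<t} \<and> int i \<le> t \<and>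
    q ` {0..<t} = {v \<in> nodes. children (nodes - q ` {0..<int i}) v = {}} \<and>
    (\<forall>v. deg v = of_bool (v = - 1) + int (card (children (nodes - q ` {0..<int i}) v))) \<and>
    (\<forall>v. sz v = (\<Sum>u\<in>children (q ` {0..<int i}) v. hook u))"

lemma peeled_subset:
  assumes "peeled i q t deg sz"
  shows "q ` {0..<int i} \<subseteq> nodes"
proof -
  have "q ` {0..<int i} \<subseteq> q ` {0..<t}" using assms unfolding peeled_def by auto
  then show ?thesis using assms unfolding peeled_def by blast
qed

lemma card_peeled:
  assumes "peeled i q t deg sz"
  shows "card (q ` {0..<int i}) = i"
proof -
  have "inj_on q {0..<int i}" using assms unfolding peeled_def by (auto intro: inj_on_subset)
  then show ?thesis by (simp add: card_image)
qed

lemma peeled_all: "peeled n q t deg sz \<Longrightarrow> q ` {0..<int n} = nodes"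
  using peeled_subset card_peeled by (intro card_subset_eq) auto

lemma queue_snoc:
  fixes q :: "int \<Rightarrow> int"
  assumes "0 \<le> t" "inj_on q {0..<t}" "x \<notin> q ` {0..<t}"
  shows "inj_on (q(t := x)) {0..<t + 1}" "(q(t := x)) ` {0..<t + 1} = insert x (q ` {0..<t})"
proof -
  have t: "{0..<t + 1} = insert t {0..<t}" using assms(1) by auto
  have im: "(q(t := x)) ` {0..<t} = q ` {0..<t}" by (rule image_cong) auto
  have "inj_on (q(t := x)) {0..<t}" using assms(2) by (simp add: inj_on_def)
  then show "inj_on (q(t := x)) {0..<t + 1}" unfolding t using im assms(3) by simp
  show "(q(t := x)) ` {0..<t + 1} = insert x (q ` {0..<t})"
    unfolding t by (simp only: image_insert im fun_upd_same)
qed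

lemma interval_Suc: "{0..<int (Suc i)} = insert (int i) {0..<int i}"
  by auto

text \<open>The next queue entry \<open>v\<close> is a leaf among the remaining nodes, so all its
  children are removed and its hook is complete. Removing \<open>v\<close> affects only the data of
  \<open>par v\<close>, the only node that can newly become a leaf.\<close>

lemma peeled_step:
  assumes p: "peeled i q t deg sz" and i: "i < n"
  defines "v \<equiv> q (int i)"
  shows "int i < t" "v \<notin> q ` {0..<int i}" "sz v + 1 = hook v"
    and "deg (par v) = 1 \<Longrightarrow>
      peeled (Suc i) (q(t := par v)) (t + 1) (deg(par v := 0)) (sz(par v := sz (par v) + hook v))"
    and "deg (par v) \<noteq> 1 \<Longrightarrow>
      peeled (Suc i) q t (deg(par v := deg (par v) - 1)) (sz(par v := sz (par v) + hook v))"
proof -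
  let ?P = "q ` {0..<int i}"
  note pd = p[unfolded peeled_def]
  have inj: "inj_on q {0..<t}"
    and W: "q ` {0..<t} = {v \<in> nodes. children (nodes - ?P) v = {}}"
    and deg: "deg x = of_bool (x = - 1) + int (card (children (nodes - ?P) x))"
    and sz: "sz x = (\<Sum>u\<in>children ?P x. hook u)" for x
    using pd by auto
  have PV: "?P \<subseteq> nodes" and cardP: "card ?P = i"
    using p peeled_subset card_peeled by auto
  then have "nodes - ?P \<noteq> {}" using i by (metis Diff_eq_empty_iff card_atLeastLessThan_int
      card_mono finite_atLeastLessThan_int finite_imageI diff_zero nat_int not_le)
  then obtain u where u: "u \<in> nodes - ?P" "children (nodes - ?P) u = {}"
    using exists_leaf[of "nodes - ?P"] by blast
  then have "u \<in> q ` {0..<t}" using W by blast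
  \<comment> \<open>The remaining leaf \<open>u\<close> is in the queue but not among its first
    \<open>i\<close> entries, so the queue is longer than \<open>i\<close>.\<close>
  then show it: "int i < t" using u(1) by force
  then have "v \<in> q ` {0..<t}" by (simp add: v_def)
  then have v: "v \<in> nodes" "children (nodes - ?P) v = {}" unfolding W by blast+
  show vP: "v \<notin> ?P"
    using inj it unfolding v_def by (auto dest: inj_onD)
  have "children ?P v = {u. u \<in> nodes \<and> par u = v}"
    using v(2) PV unfolding children_def by blast
  then show "sz v + 1 = hook v" using sz[of v] hook_rec[OF v(1)] by simp
  have P': "q ` {0..<int (Suc i)} = insert v ?P" "(q(t := x)) ` {0..<int (Suc i)} = insert v ?P" for x
    using it unfolding interval_Suc v_def by auto
  have ch: "children (nodes - insert v ?P) x =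
      (if x = par v then children (nodes - ?P) x - {v} else children (nodes - ?P) x)" for x
    by (auto simp: children_def)
  have vch: "v \<in> children (nodes - ?P) (par v)" using v(1) vP by (simp add: children_def)
  have deg': "(deg(par v := deg (par v) - 1)) x =
      of_bool (x = - 1) + int (card (children (nodes - insert v ?P) x))" for x
  proof -
    have "int (card (children (nodes - ?P) (par v) - {v})) =
        int (card (children (nodes - ?P) (par v))) - 1"
      using vch card.remove[of "children (nodes - ?P) (par v)" v] by simp
    then show ?thesis by (simp add: ch deg)
  qed
  have sz': "(sz(par v := sz (par v) + hook v)) x = (\<Sum>u\<in>children (insert v ?P) x. hook u)" for x
  proof -
    have "children (insert v ?P) x = (if x = par v then insert v (children ?P x) else children ?P x)"
      by (auto simp: children_def)
    moreover have "v \<notin> children ?P (par v)" using vP by (simp add: children_def)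
    ultimately show ?thesis by (simp add: sz)
  qed
  \<comment> \<open>Until now \<open>par v\<close> has had the remaining child \<open>v\<close>, so
    it cannot be queued twice.\<close>
  have notW: "par v \<notin> q ` {0..<t}" using W vch by auto
  have W': "{x \<in> nodes. children (nodes - insert v ?P) x = {}} =
    (if deg (par v) = 1 then insert (par v) (q ` {0..<t}) else q ` {0..<t})"
  proof -
    \<comment> \<open>At the dummy node the surplus child and \<open>v\<close> itself make the
      counter at least 2; hence the value 1 singles out a genuine node whose last remaining child is
      \<open>v\<close>.\<close>
    have "par v \<in> nodes \<and> children (nodes - insert v ?P) (par v) = {} \<longleftrightarrow> deg (par v) = 1"
      using deg'[of "par v"] par[OF v(1)] by (auto simp: of_bool_def)
    then show ?thesis unfolding W by (auto simp: ch split: if_splits)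
  qed
  show "peeled (Suc i) (q(t := par v)) (t + 1) (deg(par v := 0)) (sz(par v := sz (par v) + hook v))"
    if d: "deg (par v) = 1"
  proof -
    have "0 \<le> t" using it by simp
    note queue_snoc[OF this inj notW]
    then show ?thesis
      using deg' sz' W' it d unfolding peeled_def P' by simp
  qed
  show "peeled (Suc i) q t (deg(par v := deg (par v) - 1)) (sz(par v := sz (par v) + hook v))"
    if "deg (par v) \<noteq> 1"
    using deg' sz' W' it inj that unfolding peeled_def P' by simp
qed

section \<open>Loop invariants, correctness and cost of the program\<close>

definition initial :: state where
  "initial = \<lparr>var = (\<lambda>_. 0)(''n'' := int n), arr = (\<lambda>_ _. 0)(''parent'' := par)\<rparr>"

text \<open>The variable \<open>zero\<close> is never assigned; it keeps the default value of the
  input memory.\<close>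

definition frame :: "state \<Rightarrow> bool" where
  "frame s \<longleftrightarrow> var s ''n'' = int n \<and> var s ''one'' = 1 \<and> var s ''zero'' = 0 \<and> arr s ''parent'' = par"

text \<open>Besides its own progress, each invariant carries the still untouched starting values of
  the later loops, so that the final state of one loop satisfies the initial invariant of the
  next.\<close>

definition counted :: "nat \<Rightarrow> state \<Rightarrow> bool" where
  "counted i s \<longleftrightarrow> frame s \<and> var s ''i'' = int i \<and>
    var s ''j'' = 0 \<and> var s ''t'' = 0 \<and> var s ''h'' = 0 \<and> var s ''prod'' = 1 \<and> var s ''fact'' = 1 \<and>
    (\<forall>v. arr s ''size'' v = 0) \<and>
    (\<forall>v. arr s ''deg'' v = of_bool (v = - 1) + int (card (children {0..<int i} v)))"

definition pushed :: "nat \<Rightarrow> state \<Rightarrow> bool" where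
  "pushed i s \<longleftrightarrow> frame s \<and> var s ''j'' = int i \<and>
    var s ''h'' = 0 \<and> var s ''prod'' = 1 \<and> var s ''fact'' = 1 \<and>
    (\<forall>v. arr s ''size'' v = 0) \<and>
    (\<forall>v. arr s ''deg'' v = of_bool (v = - 1) + int (card (children nodes v))) \<and>
    0 \<le> var s ''t'' \<and> inj_on (arr s ''queue'') {0..<var s ''t''} \<and>
    arr s ''queue'' ` {0..<var s ''t''} = {v \<in> {0..<int i}. children nodes v = {}}"

definition peeling :: "nat \<Rightarrow> state \<Rightarrow> bool" where
  "peeling i s \<longleftrightarrow> frame s \<and> var s ''h'' = int i \<and>
    var s ''fact'' = fact i \<and> var s ''prod'' = prod hook (arr s ''queue'' ` {0..<int i}) \<and>
    peeled i (arr s ''queue'') (var s ''t'') (arr s ''deg'') (arr s ''size'')"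

lemma wp_count_children:
  assumes "counted 0 s"
  shows "wp count_children (\<lambda>k s'. k \<le> n * 3 + 1 \<and> counted n s') s"
proof -
  \<comment> \<open>An iteration costs two additions and one test.\<close>
  have "wp count_children (\<lambda>k s'. k \<le> n * Suc 2 + 1 \<and> counted n s') s"
    unfolding count_children_def
  proof (rule wp_While_count[where I = counted])
    fix i s assume "i < n" and c: "counted i s"
    have "children {0..<int (Suc i)} v =
        (if v = par (int i) then insert (int i) (children {0..<int i} v) else children {0..<int i} v)" for v
      unfolding interval_Suc by (auto simp: children_def)
    moreover have "int i \<notin> children {0..<int i} v" for v by (simp add: children_def)
    ultimately have "card (children {0..<int (Suc i)} v) =
        card (children {0..<int i} v) + of_bool (v = par (int i))" for v
      by simp
    then show "compare Less (var s ''i'') (var s ''n'') \<and> wp (block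
      [Load ''p'' ''parent'' ''i'', Load ''d'' ''deg'' ''p'', Arith ''d'' Add ''d'' ''one'',
       Store ''deg'' ''p'' ''d'', Arith ''i'' Add ''i'' ''one''])
      (\<lambda>k s'. k \<le> 2 \<and> counted (Suc i) s') s"
      using c \<open>i < n\<close> by (auto simp: counted_def frame_def)
  qed (use assms in \<open>auto simp: counted_def frame_def\<close>)
  then show ?thesis by (simp add: numeral_eq_Suc)
qed

lemma wp_push_leaves:
  assumes "pushed 0 s"
  shows "wp push_leaves (\<lambda>k s'. k \<le> n * 4 + 1 \<and> pushed n s') s"
proof -
  \<comment> \<open>The body costs one comparison, the increment of \<open>j\<close> and at most one
    increment of \<open>t\<close>.\<close>
  have "wp push_leaves (\<lambda>k s'. k \<le> n * Suc 3 + 1 \<and> pushed n s') s"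
    unfolding push_leaves_def
  proof (rule wp_While_count[where I = pushed])
    fix i s assume "i < n" and c: "pushed i s"
    let ?q = "arr s ''queue''" and ?t = "var s ''t''"
    have "0 \<le> ?t" "inj_on ?q {0..<?t}" "int i \<notin> ?q ` {0..<?t}" using c by (auto simp: pushed_def)
    note sn = queue_snoc[OF this]
    note sn(1)
    moreover have "(?q(?t := int i)) ` {0..<?t + 1} = {v \<in> {0..<int (Suc i)}. children nodes v = {}}"
      if "children nodes (int i) = {}"
      using c that sn(2) unfolding interval_Suc pushed_def by auto
    moreover have "?q ` {0..<?t} = {v \<in> {0..<int (Suc i)}. children nodes v = {}}"
      if "children nodes (int i) \<noteq> {}"
      using c that unfolding interval_Suc pushed_def by auto
    moreover have "arr s ''deg'' (int i) = 0 \<longleftrightarrow> children nodes (int i) = {}"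
      using c by (simp add: pushed_def)
    ultimately show "compare Less (var s ''j'') (var s ''n'') \<and> wp (block
      [Load ''d'' ''deg'' ''j'', Cond Eq ''d'' ''zero'' (push ''j'') Skip,
       Arith ''j'' Add ''j'' ''one''])
      (\<lambda>k s'. k \<le> 3 \<and> pushed (Suc i) s') s"
      using c \<open>i < n\<close>
      by (cases "children nodes (int i) = {}") (simp_all add: pushed_def frame_def push_def)
  qed (use assms in \<open>auto simp: pushed_def frame_def\<close>)
  then show ?thesis by (simp add: numeral_eq_Suc)
qed

lemma wp_peel_leaves:
  assumes "peeling 0 s"
  shows "wp peel_leaves (\<lambda>k s'. k \<le> n * 9 + 1 \<and> peeling n s') s"
proof -
  \<comment> \<open>The body costs six arithmetic operations, one comparison and at most one
    increment of \<open>t\<close>.\<close>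
  have "wp peel_leaves (\<lambda>k s'. k \<le> n * Suc 8 + 1 \<and> peeling n s') s"
    unfolding peel_leaves_def
  proof (rule wp_While_count[where I = peeling])
    fix i s assume i: "i < n" and c: "peeling i s"
    let ?q = "arr s ''queue''" and ?t = "var s ''t''"
    let ?v = "?q (int i)"
    have pe: "peeled i ?q ?t (arr s ''deg'') (arr s ''size'')" using c by (simp add: peeling_def)
    note st = peeled_step[OF pe i]
    \<comment> \<open>A push writes at index \<open>t\<close>, beyond the entries up to
      \<open>i\<close>, so the set of removed nodes is unaffected.\<close>
    have q: "(?q(?t := par ?v)) ` {0..<int (Suc i)} = ?q ` {0..<int (Suc i)}" if "arr s ''deg'' (par ?v) = 1"
      using st(1) by (intro image_cong) auto
    have "prod hook (?q ` {0..<int (Suc i)}) = prod hook (?q ` {0..<int i}) * hook ?v"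
      using st(2) unfolding interval_Suc by simp
    then show "compare Less (var s ''h'') (var s ''n'') \<and> wp (block
      [Load ''v'' ''queue'' ''h'', Arith ''h'' Add ''h'' ''one'', Load ''w'' ''size'' ''v'',
       Arith ''w'' Add ''w'' ''one'', Arith ''prod'' Mul ''prod'' ''w'',
       Arith ''fact'' Mul ''fact'' ''h'', Load ''p'' ''parent'' ''v'', Load ''d'' ''size'' ''p'',
       Arith ''d'' Add ''d'' ''w'', Store ''size'' ''p'' ''d'', Load ''d'' ''deg'' ''p'',
       Arith ''d'' Sub ''d'' ''one'', Store ''deg'' ''p'' ''d'',
       Cond Eq ''d'' ''zero'' (push ''p'') Skip])
      (\<lambda>k s'. k \<le> 8 \<and> peeling (Suc i) s') s"
      using c i st q by (auto simp: peeling_def frame_def push_def algebra_simps)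
  qed (use assms in \<open>auto simp: peeling_def frame_def\<close>)
  then show ?thesis by (simp add: numeral_eq_Suc)
qed

text \<open>The assumption makes the final division exact, and positive hooks make its divisor
  nonzero. The loops cost \<open>3 * n + 1\<close>, \<open>4 * n + 1\<close> and
  \<open>9 * n + 1\<close>, the division one.\<close>

lemma wp_count_linear_extensions:
  assumes "e * prod hook nodes = fact n"
  shows "wp count_linear_extensions (\<lambda>k s. k \<le> 16 * n + 4 \<and> var s ''result'' = e) initial"
proof -
  have divide: "wp (block [Arith ''result'' Div ''fact'' ''prod''])
      (\<lambda>k s. k \<le> 1 \<and> var s ''result'' = e) s" if "peeling n s" for s
  proof -
    have "var s ''prod'' = prod hook nodes" "var s ''fact'' = e * prod hook nodes"
      using that assms peeled_all by (auto simp: peeling_def)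
    moreover have "prod hook nodes \<noteq> 0" using hook_pos by (auto simp: less_le)
    ultimately show ?thesis by simp
  qed
  have peel: "wp (block [peel_leaves, Arith ''result'' Div ''fact'' ''prod''])
      (\<lambda>k s. k \<le> n * 9 + 1 + 1 \<and> var s ''result'' = e) s" if "pushed n s" for s
  proof -
    have "peeling 0 s" using that by (auto simp: pushed_def peeling_def peeled_def children_def)
    then show ?thesis using wp_block_bound[OF wp_peel_leaves divide] by blast
  qed
  have push: "wp (block [push_leaves, peel_leaves, Arith ''result'' Div ''fact'' ''prod''])
      (\<lambda>k s. k \<le> n * 4 + 1 + (n * 9 + 1 + 1) \<and> var s ''result'' = e) s" if "counted n s" for s
  proof -
    have "pushed 0 s" using that by (auto simp: counted_def pushed_def)
    then show ?thesis using wp_block_bound[OF wp_push_leaves peel] by blast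
  qed
  \<comment> \<open>The state after the five initial commands, none of which costs anything.\<close>
  define s where "s = set_arr ''deg'' (- 1) 1 (set_var ''p'' (- 1) (set_var ''fact'' 1
      (set_var ''prod'' 1 (set_var ''one'' 1 initial))))"
  have "counted 0 s"
    by (simp add: s_def counted_def frame_def initial_def children_def)
  from wp_block_bound[OF wp_count_children[OF this] push]
  have "wp (block [count_children, push_leaves, peel_leaves, Arith ''result'' Div ''fact'' ''prod''])
      (\<lambda>k s. k \<le> 16 * n + 4 \<and> var s ''result'' = e) s"
    by (rule wp_mono) auto
  then show ?thesis by (simp add: count_linear_extensions_def s_def initial_def)
qed

end

section \<open>Counting the linear extensions of a tree\<close>

text \<open>The mark \<open>-1\<close> of the root is never of the form \<open>int v\<close>, in
  accordance with the root having no parent; elsewhere the description operator picks the unique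
  parent.\<close>

lemma parent_tree_input:
  assumes "rooted_tree {..<n} r E" "u < n"
  shows "arr (tree_input n r E) ''parent'' (int u) = int v \<longleftrightarrow> (v, u) \<in> E"
proof (cases "u = r")
  case True
  then show ?thesis using assms by (auto simp: tree_input_def rooted_tree_def)
next
  case False
  then obtain w where w: "(w, u) \<in> E"
    using rooted_tree_parent_exists[OF assms(1)] assms(2) by auto
  moreover have "w' = w" if "(w', u) \<in> E" for w'
    using rooted_tree_parent_unique[OF assms(1) that w] .
  ultimately have "(THE w. (w, u) \<in> E) = w" "(v, u) \<in> E \<longleftrightarrow> w = v" by blast+
  then show ?thesis using False assms(2) by (auto simp: tree_input_def)
qed

lemma parent_array_tree_input:
  assumes t: "rooted_tree {..<n} r E"
  shows "parent_array n (arr (tree_input n r E) ''parent'')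
    (\<lambda>v. int (card (tree_order {..<n} E `` {nat v})))"
proof
  let ?par = "arr (tree_input n r E) ''parent''"
  have E: "E \<subseteq> {..<n} \<times> {..<n}" using t by (simp add: rooted_tree_def)
  fix v assume "v \<in> {0..<int n}"
  then obtain m where m: "v = int m" "m < n"
    by (metis atLeastLessThan_iff of_nat_less_iff zero_le_imp_eq_int)
  show "?par v \<in> insert (- 1) {0..<int n}"
  proof (cases "m = r")
    case True
    then show ?thesis using m by (simp add: tree_input_def)
  next
    case False
    then obtain w where w: "(w, m) \<in> E"
      using rooted_tree_parent_exists[OF t] m(2) by auto
    then have "?par v = int w" using parent_tree_input[OF t m(2)] m(1) by simp
    then show ?thesis using w E by auto
  qed
  have rec: "card (tree_order {..<n} E `` {m}) =
      Suc (\<Sum>c | (m, c) \<in> E. card (tree_order {..<n} E `` {c}))"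
    using card_tree_order_Image[OF t] m(2) by simp
  then show "0 < int (card (tree_order {..<n} E `` {nat v}))"
    using m(1) by (simp only: nat_int of_nat_0_less_iff zero_less_Suc)
  \<comment> \<open>Children are matched between integer indices and natural-number nodes, so that
    the recursion for subtree sizes can be reindexed.\<close>
  have "{u. u \<in> {0..<int n} \<and> ?par u = v} = int ` {c. (m, c) \<in> E}"
  proof (intro set_eqI iffI)
    fix u assume "u \<in> {u. u \<in> {0..<int n} \<and> ?par u = v}"
    then show "u \<in> int ` {c. (m, c) \<in> E}"
      using parent_tree_input[OF t, of "nat u" m] m(1) by (intro image_eqI[of _ _ "nat u"]) auto
  next
    fix u assume "u \<in> int ` {c. (m, c) \<in> E}"
    then show "u \<in> {u. u \<in> {0..<int n} \<and> ?par u = v}"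
      using parent_tree_input[OF t] m(1) E by auto
  qed
  then show "int (card (tree_order {..<n} E `` {nat v})) =
      1 + (\<Sum>u | u \<in> {0..<int n} \<and> ?par u = v. int (card (tree_order {..<n} E `` {nat u})))"
    using rec m(1) by (simp add: sum.reindex)
qed

theorem corollary37:
  shows "\<exists>(c :: com) (t :: nat \<Rightarrow> nat).
    (\<lambda>n. real (t n)) \<in> O(\<lambda>n. real n) \<and>
    (\<forall>n r E. rooted_tree {..<n} r E \<longrightarrow>
      (\<exists>k s. exec c (tree_input n r E) k s \<and>
        var s ''result'' = int (card (linear_extensions {..<n} (tree_order {..<n} E))) \<and>
        k \<le> t n))"
proof (rule exI, rule exI, intro conjI allI impI)
  \<comment> \<open>The witnesses left open by \<open>exI\<close> are determined by the goals shown: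
    the bound here, the program at the end. For n \<ge> 1 the constant 20 absorbs the additive
    4.\<close>
  show "(\<lambda>n. real (16 * n + 4)) \<in> O(\<lambda>n. real n)"
    by (rule bigoI[of _ 20]) (auto intro!: eventually_mono[OF eventually_ge_at_top[of 1]])
  fix n r and E :: "(nat \<times> nat) set"
  assume t: "rooted_tree {..<n} r E"
  define par where "par = arr (tree_input n r E) ''parent''"
  define hook where "hook v = int (card (tree_order {..<n} E `` {nat v}))" for v
  interpret parent_array n par hook
    using parent_array_tree_input[OF t] unfolding par_def hook_def .
  have "initial = tree_input n r E"
    unfolding initial_def by (simp add: par_def tree_input_def)
  moreover have "int (card (linear_extensions {..<n} (tree_order {..<n} E))) * prod hook nodes = fact n"
  proof -
    have "nodes = int ` {..<n}" by (simp add: image_int_atLeastLessThan lessThan_atLeast0)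
    then have "prod hook nodes = int (\<Prod>v<n. card (tree_order {..<n} E `` {v}))"
      by (simp add: prod.reindex hook_def)
    then show ?thesis using tree_hook_length_formula[OF t]
      by (metis card_lessThan of_nat_fact of_nat_mult)
  qed
  ultimately show "\<exists>k s. exec count_linear_extensions (tree_input n r E) k s \<and>
      var s ''result'' = int (card (linear_extensions {..<n} (tree_order {..<n} E))) \<and>
      k \<le> 16 * n + 4"
    using wp_count_linear_extensions unfolding wp_def by metis
qed

end
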